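(* Let $B$ be a unital algebra over $\mathbb{C}$ and $B\langle X\rangle=B*_{\mathbb{C}}\mathbb{C}\langle X\rangle$. For any $q\in B\langle X\rangle$ the following conditions are equivalent: (1) there exists $p\in B\langle X\rangle$ such that $\delta_{X:B}[p]=q$; (2) $q\in\ker(\Theta)$, where $\Theta=\mathrm{id}_{B\langle X\rangle}-\rho$ and $\rho:B\langle X\rangle\to B\langle X\rangle$ is the linear map with $\rho[b_0Xb_1\cdots Xb_n]=b_1Xb_2\cdots Xb_nXb_0$.
   Context: $B*_{\mathbb{C}}\mathbb{C}\langle X\rangle$ is the algebraic free product (amalgamated over $\mathbb{C}1$) of $B$ and the polynomial algebra in one indeterminate $X$; it is spanned by monomials $b_0Xb_1X\cdots Xb_n$ with $n\ge0$, $b_i\in B$ (for $n=0$, $\rho[b_0]=b_0$). The free difference quotient $\partial_{X:B}:B\langle X\rangle\to B\langle X\rangle\otimes B\langle X\rangle$ is the derivation with $\partial_{X:B}[X]=1\otimes1$ and $\partial_{X:B}[b]=0$ for $b\in B$, i.e. $\partial_{X:B}[b_0Xb_1\cdots Xb_n]=\sum_{i=1}^{n}b_0X\cdots Xb_{i-1}\otimes b_iX\cdots Xb_n$. The cyclic derivative is $\delta_{X:B}=\mu\circ\sigma\circ\partial_{X:B}:B\langle X\rangle\to B\langle X\rangle$ with $\sigma(p\otimes q)=q\otimes p$ and $\mu(p\otimes q)=pq$. *)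

theory Defs
  imports Complex_Main "HOL-Library.Poly_Mapping"
begin

section \<open>Complex vector spaces and unital complex algebras\<close>

class complex_vector = ab_group_add +
  fixes scaleC :: "complex \<Rightarrow> 'a \<Rightarrow> 'a" (infixr "*\<^sub>C" 75)
  assumes scaleC_add_right: "c *\<^sub>C (x + y) = c *\<^sub>C x + c *\<^sub>C y"
    and scaleC_add_left: "(c + d) *\<^sub>C x = c *\<^sub>C x + d *\<^sub>C x"
    and scaleC_scaleC: "c *\<^sub>C d *\<^sub>C x = (c * d) *\<^sub>C x"
    and scaleC_one: "1 *\<^sub>C x = x"

global_interpretation complex_vector: vector_space "scaleC :: complex \<Rightarrow> 'a \<Rightarrow> 'a::complex_vector"
  by standard (simp_all add: scaleC_add_right scaleC_add_left scaleC_scaleC scaleC_one)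

abbreviation clinear :: "('a::complex_vector \<Rightarrow> 'b::complex_vector) \<Rightarrow> bool"
  where "clinear \<equiv> Vector_Spaces.linear scaleC scaleC"

text \<open>In contrast to \<^class>\<open>ring_1\<close>, the following class does not require that one differs from
  zero, so that the zero algebra is an instance.\<close>

class unital_complex_algebra = complex_vector + ring + monoid_mult +
  assumes mult_scaleC_left: "(c *\<^sub>C x) * y = c *\<^sub>C (x * y)"
    and mult_scaleC_right: "x * (c *\<^sub>C y) = c *\<^sub>C (x * y)"

lemma clinear_iff:
  "clinear f \<longleftrightarrow> (\<forall>x y. f (x + y) = f x + f y) \<and> (\<forall>c x. f (c *\<^sub>C x) = c *\<^sub>C f x)"
  by (simp add: Vector_Spaces.linear_iff complex_vector.vector_space_axioms)

lemma clinear_zero: "clinear f \<Longrightarrow> f 0 = 0"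
  by (metis clinear_iff complex_vector.scale_zero_left)

lemma clinear_diff: "clinear f \<Longrightarrow> f (x - y) = f x - f y"
  unfolding clinear_iff by (metis add_diff_cancel_right' diff_add_cancel)

lemma clinear_sum: "clinear f \<Longrightarrow> f (\<Sum>i\<in>I. g i) = (\<Sum>i\<in>I. f (g i))"
  by (induction I rule: infinite_finite_induct) (auto simp: clinear_iff clinear_zero)

lemma clinear_sum_fun:
  assumes "\<And>i. i \<in> I \<Longrightarrow> clinear (f i)"
  shows "clinear (\<lambda>x. \<Sum>i\<in>I. f i x)"
  using assms by (auto simp: clinear_iff sum.distrib complex_vector.scale_sum_right)

lemma clinear_scale: "clinear f \<Longrightarrow> clinear (\<lambda>x. c *\<^sub>C f x)"
  by (simp add: clinear_iff scaleC_add_right scaleC_scaleC mult.commute)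

lemma clinear_const0: "clinear (\<lambda>x. 0)"
  by (auto simp: clinear_iff)

lemma clinear_ident: "clinear (\<lambda>x. x)"
  by (auto simp: clinear_iff)

lemma clinear_compose: "clinear f \<Longrightarrow> clinear g \<Longrightarrow> clinear (\<lambda>x. f (g x))"
  by (auto simp: clinear_iff)

lemma clinear_add: "clinear f \<Longrightarrow> clinear g \<Longrightarrow> clinear (\<lambda>x. f x + g x)"
  by (auto simp: clinear_iff algebra_simps scaleC_add_right)

lemma clinear_mult_left: "clinear (\<lambda>x. x * y :: 'a::unital_complex_algebra)"
  by (auto simp: clinear_iff algebra_simps mult_scaleC_left)

lemma clinear_mult_right: "clinear (\<lambda>y. x * y :: 'a::unital_complex_algebra)"
  by (auto simp: clinear_iff algebra_simps mult_scaleC_right)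

section \<open>Free complex vector spaces\<close>

instantiation complex :: complex_vector
begin
definition scaleC_complex :: "complex \<Rightarrow> complex \<Rightarrow> complex"
  where "scaleC_complex c x = c * x"
instance by standard (simp_all add: scaleC_complex_def algebra_simps)
end

instantiation poly_mapping :: (type, complex_vector) complex_vector
begin
definition scaleC_poly_mapping :: "complex \<Rightarrow> ('a \<Rightarrow>\<^sub>0 'b) \<Rightarrow> ('a \<Rightarrow>\<^sub>0 'b)"
  where "scaleC_poly_mapping c = Poly_Mapping.map (scaleC c)"

lemma lookup_scaleC: "Poly_Mapping.lookup (c *\<^sub>C f) k = c *\<^sub>C Poly_Mapping.lookup f k"
  for f :: "'a \<Rightarrow>\<^sub>0 'b"
  by (auto simp: scaleC_poly_mapping_def Poly_Mapping.map.rep_eq when_def)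

instance
  by standard (rule poly_mapping_eqI, 
      simp add: lookup_scaleC lookup_add scaleC_add_right scaleC_add_left scaleC_scaleC scaleC_one)+
end

text \<open>The linear extension of a map on the basis of a free vector space.\<close>

definition lin_ext :: "('k \<Rightarrow> 'v::complex_vector) \<Rightarrow> ('k \<Rightarrow>\<^sub>0 complex) \<Rightarrow> 'v"
  where "lin_ext g f = (\<Sum>k\<in>Poly_Mapping.keys f. Poly_Mapping.lookup f k *\<^sub>C g k)"

lemma lin_ext_superset:
  assumes "finite A" "Poly_Mapping.keys f \<subseteq> A"
  shows "lin_ext g f = (\<Sum>k\<in>A. Poly_Mapping.lookup f k *\<^sub>C g k)"
  unfolding lin_ext_def using assms
  by (intro sum.mono_neutral_left) (auto simp: in_keys_iff)

lemma clinear_lin_ext: "clinear (lin_ext g)"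
  unfolding clinear_iff
proof (intro conjI allI)
  fix f h :: "'a \<Rightarrow>\<^sub>0 complex" and c
  let ?A = "Poly_Mapping.keys f \<union> Poly_Mapping.keys h"
  have *: "finite ?A" by simp
  show "lin_ext g (f + h) = lin_ext g f + lin_ext g h"
    using lin_ext_superset[OF *, of f g] lin_ext_superset[OF *, of h g]
      lin_ext_superset[OF *, of "f + h" g] Poly_Mapping.keys_add[of f h]
    by (simp add: lookup_add scaleC_add_left sum.distrib)
  have "Poly_Mapping.keys (c *\<^sub>C f) \<subseteq> Poly_Mapping.keys f"
    by (auto simp: in_keys_iff lookup_scaleC)
  then show "lin_ext g (c *\<^sub>C f) = c *\<^sub>C lin_ext g f"
    using lin_ext_superset[of "Poly_Mapping.keys f" "c *\<^sub>C f" g]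
    by (simp add: lin_ext_def lookup_scaleC complex_vector.scale_sum_right scaleC_complex_def scaleC_scaleC)
qed

lemma lin_ext_single: "lin_ext g (Poly_Mapping.single k c) = c *\<^sub>C g k"
  using lin_ext_superset[of "{k}" "Poly_Mapping.single k c" g] by (simp split: if_splits)

lemma scaleC_single: "c *\<^sub>C Poly_Mapping.single k d = Poly_Mapping.single k (c * d)" for d :: complex
  by (rule poly_mapping_eqI) (simp add: lookup_scaleC lookup_single scaleC_complex_def when_def)

lemma free_induct:
  fixes f :: "'k \<Rightarrow>\<^sub>0 complex"
  shows "f = (\<Sum>k\<in>Poly_Mapping.keys f. Poly_Mapping.lookup f k *\<^sub>C Poly_Mapping.single k 1)"
  by (rule poly_mapping_eqI)
    (auto simp: lookup_sum lookup_scaleC lookup_single scaleC_complex_def when_def in_keys_iff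
       if_distrib sum.delta cong: if_cong)

lemma lin_ext_span:
  assumes "\<And>r. r \<in> R \<Longrightarrow> lin_ext g r = 0" "f \<in> complex_vector.span R"
  shows "lin_ext g f = 0"
  using assms(2)
proof (induction rule: complex_vector.span_induct_alt)
  case base
  show ?case by (rule clinear_zero[OF clinear_lin_ext])
next
  case (step c x y)
  then show ?case using clinear_lin_ext[of g] assms(1) by (auto simp: clinear_iff)
qed

section \<open>The algebra B<X>\<close>

text \<open>As a complex vector space, the free product of \<open>B\<close> with the polynomial algebra in \<open>X\<close> is the
  direct sum of the tensor powers of \<open>B\<close> with at least one factor, the pure tensor of \<open>b\<^sub>0, \<dots>, b\<^sub>n\<close>
  being the monomial \<open>b\<^sub>0 X b\<^sub>1 \<dots> X b\<^sub>n\<close>. It is obtained here from the free vector space on all lists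
  \<open>[b\<^sub>0, \<dots>, b\<^sub>n]\<close> by dividing out multilinearity. The empty list is no monomial and
  is set to zero. The lemma \<open>free_product_ex1\<close> below shows that the resulting
  algebra has the universal property of the free product.\<close>

inductive_set word_relations :: "('b::complex_vector list \<Rightarrow>\<^sub>0 complex) set" where
  word_empty: "Poly_Mapping.single [] 1 \<in> word_relations"
| word_add: "Poly_Mapping.single (xs @ (b + c) # ys) 1
    - Poly_Mapping.single (xs @ b # ys) 1 - Poly_Mapping.single (xs @ c # ys) 1 \<in> word_relations"
| word_scale: "Poly_Mapping.single (xs @ (s *\<^sub>C b) # ys) 1
    - s *\<^sub>C Poly_Mapping.single (xs @ b # ys) 1 \<in> word_relations"

definition word_equiv :: "('b::complex_vector list \<Rightarrow>\<^sub>0 complex) \<Rightarrow> ('b list \<Rightarrow>\<^sub>0 complex) \<Rightarrow> bool"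
  where "word_equiv f g \<longleftrightarrow> f - g \<in> complex_vector.span word_relations"

lemma span_equivp:
  "equivp (\<lambda>f g. f - g \<in> complex_vector.span (R :: 'a::complex_vector set))"
proof (rule equivpI)
  show "reflp (\<lambda>f g. f - g \<in> complex_vector.span R)"
    by (auto simp: reflp_def complex_vector.span_zero)
  show "symp (\<lambda>f g. f - g \<in> complex_vector.span R)"
    by (metis (mono_tags, lifting) complex_vector.span_neg minus_diff_eq sympI)
  show "transp (\<lambda>f g. f - g \<in> complex_vector.span R)"
    by (rule transpI) (drule (1) complex_vector.span_add, simp)
qed

quotient_type (overloaded) 'b free_X = "'b::complex_vector list \<Rightarrow>\<^sub>0 complex" / word_equiv
  morphisms rep_free_X abs_free_X
  using span_equivp[of word_relations] by (simp add: word_equiv_def[abs_def])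

instantiation free_X :: (complex_vector) complex_vector
begin
lift_definition zero_free_X :: "'a free_X" is 0 .
lift_definition plus_free_X :: "'a free_X \<Rightarrow> 'a free_X \<Rightarrow> 'a free_X" is "(+)"
  unfolding word_equiv_def by (metis add_diff_add complex_vector.span_add)
lift_definition minus_free_X :: "'a free_X \<Rightarrow> 'a free_X \<Rightarrow> 'a free_X" is "(-)"
  unfolding word_equiv_def
  by (drule (1) complex_vector.span_diff) (simp add: algebra_simps)
lift_definition uminus_free_X :: "'a free_X \<Rightarrow> 'a free_X" is "uminus"
  unfolding word_equiv_def
  by (metis complex_vector.span_neg minus_diff_minus)
lift_definition scaleC_free_X :: "complex \<Rightarrow> 'a free_X \<Rightarrow> 'a free_X" is "scaleC"
  unfolding word_equiv_def
  by (metis complex_vector.span_scale complex_vector.scale_right_diff_distrib)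
instance
  by standard
    (transfer, simp add: word_equiv_def complex_vector.span_zero scaleC_add_right
       scaleC_add_left scaleC_scaleC scaleC_one algebra_simps)+
end

definition monom :: "'b::complex_vector list \<Rightarrow> 'b free_X"
  where "monom bs = abs_free_X (Poly_Mapping.single bs 1)"

definition multilinear :: "('b::complex_vector list \<Rightarrow> 'v::complex_vector) \<Rightarrow> bool"
  where "multilinear g \<longleftrightarrow> g [] = 0 \<and> (\<forall>xs ys. clinear (\<lambda>b. g (xs @ b # ys)))"

text \<open>The linear map taking each monomial to the value of \<open>g\<close> at its list of coefficients. It is
  independent of the chosen representatives whenever \<open>g\<close> is multilinear (\<open>lift_monom_monom\<close>).\<close>

definition lift_monom :: "('b::complex_vector list \<Rightarrow> 'v::complex_vector) \<Rightarrow> 'b free_X \<Rightarrow> 'v"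
  where "lift_monom g p = lin_ext g (rep_free_X p)"

lemma clinear_abs_free_X: "clinear abs_free_X"
  by (auto simp: clinear_iff plus_free_X.abs_eq scaleC_free_X.abs_eq)

lemma lift_monom_abs:
  assumes "multilinear g"
  shows "lift_monom g (abs_free_X f) = lin_ext g f"
proof -
  have "word_equiv (rep_free_X (abs_free_X f)) f"
    by (rule Quotient3_rep_abs[OF Quotient3_free_X]) (simp add: free_X.abs_eq_iff[symmetric])
  then have "rep_free_X (abs_free_X f) - f \<in> complex_vector.span word_relations"
    by (simp add: word_equiv_def)
  moreover have "lin_ext g r = 0" if "r \<in> word_relations" for r
    using that
    by cases (use assms clinear_lin_ext[of g] in
      \<open>auto simp: multilinear_def clinear_iff lin_ext_single scaleC_one
        clinear_diff[OF clinear_lin_ext]\<close>)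
  ultimately have "lin_ext g (rep_free_X (abs_free_X f) - f) = 0"
    by (rule lin_ext_span[rotated])
  then show ?thesis by (simp add: lift_monom_def clinear_diff[OF clinear_lin_ext])
qed

lemma lift_monom_monom [simp]: "multilinear g \<Longrightarrow> lift_monom g (monom bs) = g bs"
  by (simp add: monom_def lift_monom_abs lin_ext_single scaleC_one)

lemma clinear_lift_monom:
  assumes "multilinear g"
  shows "clinear (lift_monom g)"
  unfolding clinear_iff
proof (intro conjI allI)
  fix p q :: "'a free_X" and c
  obtain f h :: "'a list \<Rightarrow>\<^sub>0 complex" where [simp]: "p = abs_free_X f" "q = abs_free_X h"
    by (metis Quotient3_abs_rep[OF Quotient3_free_X])
  note [simp] = lift_monom_abs[OF assms]
  show "lift_monom g (p + q) = lift_monom g p + lift_monom g q"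
    using clinear_lin_ext[of g] assms by (simp add: plus_free_X.abs_eq lift_monom_abs clinear_iff)
  show "lift_monom g (c *\<^sub>C p) = c *\<^sub>C lift_monom g p"
    using clinear_lin_ext[of g] assms by (simp add: scaleC_free_X.abs_eq lift_monom_abs clinear_iff)
qed

lemma multilinear_monom: "multilinear monom"
  unfolding multilinear_def clinear_iff
proof (intro conjI allI)
  show "monom ([] :: 'a list) = 0"
    unfolding monom_def zero_free_X_def free_X.abs_eq_iff word_equiv_def
    by (simp add: complex_vector.span_base word_empty)
next
  fix xs ys :: "'a list" and b c s
  show "monom (xs @ (b + c) # ys) = monom (xs @ b # ys) + monom (xs @ c # ys)"
    unfolding monom_def plus_free_X.abs_eq free_X.abs_eq_iff word_equiv_def
    using complex_vector.span_base[OF word_add[of xs b c ys]] by (simp add: diff_diff_eq)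
  show "monom (xs @ (s *\<^sub>C b) # ys) = s *\<^sub>C monom (xs @ b # ys)"
    unfolding monom_def scaleC_free_X.abs_eq free_X.abs_eq_iff word_equiv_def
    by (rule complex_vector.span_base[OF word_scale])
qed

lemma clinear_monom: "clinear (\<lambda>b. monom (as @ b # bs))"
  by (rule multilinear_monom[unfolded multilinear_def, THEN conjunct2, rule_format])

lemma monom_Nil [simp]: "monom [] = 0"
  by (rule multilinear_monom[unfolded multilinear_def, THEN conjunct1])

lemma monom_expansion: "\<exists>A a. finite A \<and> p = (\<Sum>bs\<in>A. a bs *\<^sub>C monom bs)"
proof -
  obtain f where [simp]: "p = abs_free_X f"
    by (metis Quotient3_abs_rep[OF Quotient3_free_X])
  have "abs_free_X f = abs_free_X (\<Sum>k\<in>Poly_Mapping.keys f. Poly_Mapping.lookup f k *\<^sub>C Poly_Mapping.single k 1)"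
    using free_induct[of f] by simp
  also have "\<dots> = (\<Sum>k\<in>Poly_Mapping.keys f. Poly_Mapping.lookup f k *\<^sub>C monom k)"
    by (simp add: clinear_sum[OF clinear_abs_free_X] monom_def
        clinear_abs_free_X[unfolded clinear_iff])
  finally have "p = (\<Sum>k\<in>Poly_Mapping.keys f. Poly_Mapping.lookup f k *\<^sub>C monom k)" by simp
  then show ?thesis using finite_keys by blast
qed

lemma clinear_eq_on_monom:
  assumes "clinear f" "clinear g" "\<And>bs. bs \<noteq> [] \<Longrightarrow> f (monom bs) = g (monom bs)"
  shows "f p = g p"
proof -
  have *: "f (monom bs) = g (monom bs)" for bs
    using assms by (cases "bs = []") (auto simp: clinear_zero)
  obtain A a where "finite A" "p = (\<Sum>bs\<in>A. a bs *\<^sub>C monom bs)"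
    using monom_expansion by blast
  then show ?thesis
    using assms(1,2) * by (simp add: clinear_sum) (simp add: clinear_iff)
qed


lemma clinear_lift_monom_param:
  assumes "\<And>bs. clinear (\<lambda>x. G x bs)"
  shows "clinear (\<lambda>x. lift_monom (G x) p)"
proof -
  have "clinear (\<lambda>x. c *\<^sub>C G x bs)" for c bs
    using assms by (rule clinear_scale)
  then show ?thesis
    unfolding lift_monom_def lin_ext_def by (rule clinear_sum_fun)
qed

text \<open>\<open>(b\<^sub>0 X \<dots> X b\<^sub>m) \<cdot> (c\<^sub>0 X \<dots> X c\<^sub>n) = b\<^sub>0 X \<dots> X (b\<^sub>m c\<^sub>0) X \<dots> X c\<^sub>n\<close>\<close>

definition word_mult :: "'b::unital_complex_algebra list \<Rightarrow> 'b list \<Rightarrow> 'b list" where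
  "word_mult xs ys =
     (if xs = [] \<or> ys = [] then [] else butlast xs @ (last xs * hd ys) # tl ys)"

lemma multilinear_word_mult_right: "multilinear (\<lambda>ys. monom (word_mult xs ys))"
  unfolding multilinear_def
proof (intro conjI allI)
  fix us vs :: "'a list"
  show "clinear (\<lambda>b. monom (word_mult xs (us @ b # vs)))"
  proof (cases "xs = []")
    case False
    show ?thesis
    proof (cases us)
      case Nil
      then show ?thesis
        using clinear_compose[OF clinear_monom[of "butlast xs" vs] clinear_mult_right[of "last xs"]] False
        by (simp add: word_mult_def)
    next
      case (Cons u us')
      then show ?thesis
        using clinear_monom[of "butlast xs @ (last xs * u) # us'" vs] False
        by (simp add: word_mult_def)
    qed
  qed (simp add: word_mult_def clinear_const0)
qed (simp add: word_mult_def)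

lemma multilinear_word_mult_left: "multilinear (\<lambda>xs. monom (word_mult xs ys))"
  unfolding multilinear_def
proof (intro conjI allI)
  fix us vs :: "'a list"
  show "clinear (\<lambda>b. monom (word_mult (us @ b # vs) ys))"
  proof (cases "ys = []")
    case False
    show ?thesis
    proof (cases "vs = []")
      case True
      then show ?thesis
        using clinear_compose[OF clinear_monom[of us "tl ys"] clinear_mult_left[of "hd ys"]] False
        by (simp add: word_mult_def)
    next
      case vs: False
      then show ?thesis
        using clinear_monom[of us "butlast vs @ (last vs * hd ys) # tl ys"] False
        by (simp add: word_mult_def butlast_append)
    qed
  qed (simp add: word_mult_def clinear_const0)
qed (simp add: word_mult_def)

lemma word_mult_assoc: "word_mult (word_mult xs ys) zs = word_mult xs (word_mult ys zs)"
  by (cases ys rule: rev_cases; cases ys)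
    (auto simp: word_mult_def butlast_append hd_append tl_append mult.assoc split: list.splits)

instantiation free_X :: (unital_complex_algebra) unital_complex_algebra
begin

definition one_free_X :: "'a free_X"
  where "one_free_X = monom [1]"

definition times_free_X :: "'a free_X \<Rightarrow> 'a free_X \<Rightarrow> 'a free_X"
  where "times_free_X p q = lift_monom (\<lambda>xs. lift_monom (\<lambda>ys. monom (word_mult xs ys)) q) p"

lemma multilinear_times:
  "multilinear (\<lambda>xs. lift_monom (\<lambda>ys. monom (word_mult xs ys)) q)" for q :: "'a free_X"
  unfolding multilinear_def
proof (intro conjI allI)
  show "lift_monom (\<lambda>ys. monom (word_mult [] ys)) q = 0"
    by (simp add: word_mult_def lift_monom_def lin_ext_def)
  show "clinear (\<lambda>b. lift_monom (\<lambda>ys. monom (word_mult (us @ b # vs) ys)) q)" for us vs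
    by (rule clinear_lift_monom_param)
      (use multilinear_word_mult_left in \<open>auto simp: multilinear_def\<close>)
qed

lemma monom_mult: "monom xs * monom ys = monom (word_mult xs ys)" for xs :: "'a list"
  by (simp add: times_free_X_def multilinear_times multilinear_word_mult_left
      multilinear_word_mult_right)

lemma clinear_times_left: "clinear (\<lambda>p. p * q)" for q :: "'a free_X"
  unfolding times_free_X_def by (rule clinear_lift_monom[OF multilinear_times])

lemma clinear_times_right: "clinear (\<lambda>q. p * q)" for p :: "'a free_X"
proof -
  have "clinear (\<lambda>q. \<Sum>xs\<in>Poly_Mapping.keys (rep_free_X p). Poly_Mapping.lookup (rep_free_X p) xs *\<^sub>C
          lift_monom (\<lambda>ys. monom (word_mult xs ys)) q)"
    by (intro clinear_sum_fun clinear_scale clinear_lift_monom[OF multilinear_word_mult_right])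
  then show ?thesis
    unfolding times_free_X_def lift_monom_def[of "\<lambda>xs. lift_monom (\<lambda>ys. monom (word_mult xs ys)) _"]
      lin_ext_def[of "\<lambda>xs. lift_monom (\<lambda>ys. monom (word_mult xs ys)) _"] .
qed

instance
proof
  fix p q r :: "'a free_X" and c
  show "(p + q) * r = p * r + q * r" "(c *\<^sub>C p) * q = c *\<^sub>C (p * q)"
    using clinear_times_left by (auto simp: clinear_iff)
  show "p * (q + r) = p * q + p * r" "p * (c *\<^sub>C q) = c *\<^sub>C (p * q)"
    using clinear_times_right by (auto simp: clinear_iff)
  show "p * q * r = p * (q * r)"
  proof (rule clinear_eq_on_monom[of "\<lambda>p. p * q * r" "\<lambda>p. p * (q * r)"])
    show "clinear (\<lambda>p. p * q * r)"
      by (rule clinear_compose[OF clinear_times_left clinear_times_left])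
    fix xs :: "'a list"
    show "monom xs * q * r = monom xs * (q * r)"
    proof (rule clinear_eq_on_monom[of "\<lambda>q. monom xs * q * r" "\<lambda>q. monom xs * (q * r)"])
      show "clinear (\<lambda>q. monom xs * q * r)"
        by (rule clinear_compose[OF clinear_times_left clinear_times_right])
      show "clinear (\<lambda>q. monom xs * (q * r))"
        by (rule clinear_compose[OF clinear_times_right clinear_times_left])
      fix ys :: "'a list"
      show "monom xs * monom ys * r = monom xs * (monom ys * r)"
      proof (rule clinear_eq_on_monom[of "\<lambda>r. monom xs * monom ys * r"])
        show "clinear (\<lambda>r. monom xs * (monom ys * r))"
          by (rule clinear_compose[OF clinear_times_right clinear_times_right])
      qed (simp_all add: monom_mult word_mult_assoc clinear_times_right)
    qed
  qed (rule clinear_times_left)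
  show "1 * p = p"
    by (rule clinear_eq_on_monom[of "\<lambda>p. 1 * p" "\<lambda>p. p"])
      (auto simp: clinear_times_right clinear_ident one_free_X_def monom_mult word_mult_def)
  show "p * 1 = p"
    by (rule clinear_eq_on_monom[of "\<lambda>p. p * 1" "\<lambda>p. p"])
      (auto simp: clinear_times_left clinear_ident one_free_X_def monom_mult word_mult_def)
qed

end

definition coef :: "'b::unital_complex_algebra \<Rightarrow> 'b free_X"
  where "coef b = monom [b]"

definition var_X :: "'b::unital_complex_algebra free_X"
  where "var_X = monom [1, 1]"

lemma monom_eq_prod: "monom (b # bs) = coef b * prod_list (map (\<lambda>c. var_X * coef c) bs)"
proof (induction bs arbitrary: b)
  case (Cons c bs)
  have "monom (b # c # bs) = coef b * var_X * monom (c # bs)"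
    by (simp add: coef_def var_X_def monom_mult word_mult_def)
  then show ?case by (simp add: Cons.IH mult.assoc)
qed (simp add: coef_def)

definition unital_hom :: "('a::unital_complex_algebra \<Rightarrow> 'c::unital_complex_algebra) \<Rightarrow> bool"
  where "unital_hom f \<longleftrightarrow> clinear f \<and> f 1 = 1 \<and> (\<forall>x y. f (x * y) = f x * f y)"

lemma unital_hom_coef: "unital_hom coef"
proof -
  show ?thesis
    unfolding unital_hom_def using clinear_monom[of "[]" "[]"] by (simp add: coef_def[abs_def] one_free_X_def monom_mult word_mult_def)
qed

lemma word_value_linear:
  fixes \<phi> :: "'b::unital_complex_algebra \<Rightarrow> 'c::unital_complex_algebra"
  assumes "clinear \<phi>"
  shows "clinear (\<lambda>b. \<phi> (hd (xs @ b # ys)) * prod_list (map (\<lambda>c. a * \<phi> c) (tl (xs @ b # ys))))"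
proof (cases xs)
  case Nil
  then show ?thesis
    using clinear_compose[OF clinear_mult_left assms] by simp
next
  case (Cons x xs')
  let ?L = "\<phi> x * prod_list (map (\<lambda>c. a * \<phi> c) xs') * a"
  let ?R = "prod_list (map (\<lambda>c. a * \<phi> c) ys)"
  have "clinear (\<lambda>b. ?L * (\<phi> b * ?R))"
    by (intro clinear_compose[OF clinear_mult_right] clinear_compose[OF clinear_mult_left] assms)
  then show ?thesis by (simp add: Cons mult.assoc)
qed

text \<open>The universal property of the free product of \<open>B\<close> with the polynomial algebra, a unital
  homomorphism on the latter being given by the image \<open>a\<close> of the indeterminate.\<close>

lemma free_product_ex1:
  fixes \<phi> :: "'b::unital_complex_algebra \<Rightarrow> 'c::unital_complex_algebra"
  assumes "unital_hom \<phi>"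
  shows "\<exists>!\<Phi>. unital_hom \<Phi> \<and> (\<forall>b. \<Phi> (coef b) = \<phi> b) \<and> \<Phi> var_X = a"
proof (rule ex_ex1I)
  define g where "g bs = (if bs = [] then 0
    else \<phi> (hd bs) * prod_list (map (\<lambda>c. a * \<phi> c) (tl bs)))" for bs
  have lin: "clinear \<phi>" and one: "\<phi> 1 = 1" and mult: "\<phi> (x * y) = \<phi> x * \<phi> y" for x y
    using assms by (auto simp: unital_hom_def)
  have g: "multilinear g"
    using word_value_linear[OF lin, of _ _ a] by (simp add: multilinear_def g_def)
  have g_mult: "g (word_mult xs ys) = g xs * g ys" for xs ys
  proof (cases xs rule: rev_cases)
    case (snoc us b)
    then show ?thesis
      by (cases us; cases ys) (simp_all add: g_def word_mult_def mult mult.assoc)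
  qed (simp add: g_def word_mult_def)
  let ?\<Phi> = "lift_monom g"
  have "?\<Phi> (p * q) = ?\<Phi> p * ?\<Phi> q" for p q
  proof (rule clinear_eq_on_monom[of "\<lambda>p. ?\<Phi> (p * q)" "\<lambda>p. ?\<Phi> p * ?\<Phi> q"])
    show "clinear (\<lambda>p. ?\<Phi> (p * q))"
      by (rule clinear_compose[OF clinear_lift_monom[OF g] clinear_mult_left])
    show "clinear (\<lambda>p. ?\<Phi> p * ?\<Phi> q)"
      by (rule clinear_compose[OF clinear_mult_left clinear_lift_monom[OF g]])
    fix xs
    show "?\<Phi> (monom xs * q) = ?\<Phi> (monom xs) * ?\<Phi> q"
    proof (rule clinear_eq_on_monom[of "\<lambda>q. ?\<Phi> (monom xs * q)" "\<lambda>q. ?\<Phi> (monom xs) * ?\<Phi> q"])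
      show "clinear (\<lambda>q. ?\<Phi> (monom xs * q))"
        by (rule clinear_compose[OF clinear_lift_monom[OF g] clinear_mult_right])
      show "clinear (\<lambda>q. ?\<Phi> (monom xs) * ?\<Phi> q)"
        by (rule clinear_compose[OF clinear_mult_right clinear_lift_monom[OF g]])
    qed (simp add: monom_mult g g_mult)
  qed
  then have "unital_hom ?\<Phi> \<and> (\<forall>b. ?\<Phi> (coef b) = \<phi> b) \<and> ?\<Phi> var_X = a"
    by (simp add: unital_hom_def clinear_lift_monom g one_free_X_def coef_def var_X_def)
      (simp add: g_def one)
  then show "\<exists>\<Phi>. unital_hom \<Phi> \<and> (\<forall>b. \<Phi> (coef b) = \<phi> b) \<and> \<Phi> var_X = a" by blast
next
  fix \<Phi> \<Psi>
  assume \<Phi>: "unital_hom \<Phi> \<and> (\<forall>b. \<Phi> (coef b) = \<phi> b) \<and> \<Phi> var_X = a"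
    and \<Psi>: "unital_hom \<Psi> \<and> (\<forall>b. \<Psi> (coef b) = \<phi> b) \<and> \<Psi> var_X = a"
  have "\<Phi> (prod_list (map (\<lambda>c. var_X * coef c) bs)) = \<Psi> (prod_list (map (\<lambda>c. var_X * coef c) bs))"
    for bs
    using \<Phi> \<Psi> by (induction bs) (auto simp: unital_hom_def)
  then have "\<Phi> (monom bs) = \<Psi> (monom bs)" if "bs \<noteq> []" for bs
    using that \<Phi> \<Psi> by (cases bs) (auto simp: monom_eq_prod unital_hom_def)
  then show "\<Phi> = \<Psi>"
    using \<Phi> \<Psi> clinear_eq_on_monom[of \<Phi> \<Psi>] by (auto simp: unital_hom_def)
qed

section \<open>Tensor products\<close>

inductive_set tensor_relations ::
    "(('a::complex_vector \<times> 'b::complex_vector) \<Rightarrow>\<^sub>0 complex) set" where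
  tensor_add_left: "Poly_Mapping.single (x + x', y) 1
    - Poly_Mapping.single (x, y) 1 - Poly_Mapping.single (x', y) 1 \<in> tensor_relations"
| tensor_add_right: "Poly_Mapping.single (x, y + y') 1
    - Poly_Mapping.single (x, y) 1 - Poly_Mapping.single (x, y') 1 \<in> tensor_relations"
| tensor_scale_left: "Poly_Mapping.single (s *\<^sub>C x, y) 1
    - s *\<^sub>C Poly_Mapping.single (x, y) 1 \<in> tensor_relations"
| tensor_scale_right: "Poly_Mapping.single (x, s *\<^sub>C y) 1
    - s *\<^sub>C Poly_Mapping.single (x, y) 1 \<in> tensor_relations"

definition tensor_equiv ::
    "(('a::complex_vector \<times> 'b::complex_vector) \<Rightarrow>\<^sub>0 complex) \<Rightarrow> (('a \<times> 'b) \<Rightarrow>\<^sub>0 complex) \<Rightarrow> bool"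
  where "tensor_equiv f g \<longleftrightarrow> f - g \<in> complex_vector.span tensor_relations"

quotient_type (overloaded) ('a, 'b) tensor =
    "('a::complex_vector \<times> 'b::complex_vector) \<Rightarrow>\<^sub>0 complex" / tensor_equiv
  morphisms rep_tensor abs_tensor
  using span_equivp[of tensor_relations] by (simp add: tensor_equiv_def[abs_def])

instantiation tensor :: (complex_vector, complex_vector) complex_vector
begin
lift_definition zero_tensor :: "('a, 'b) tensor" is 0 .
lift_definition plus_tensor :: "('a, 'b) tensor \<Rightarrow> ('a, 'b) tensor \<Rightarrow> ('a, 'b) tensor" is "(+)"
  unfolding tensor_equiv_def by (metis add_diff_add complex_vector.span_add)
lift_definition minus_tensor :: "('a, 'b) tensor \<Rightarrow> ('a, 'b) tensor \<Rightarrow> ('a, 'b) tensor" is "(-)"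
  unfolding tensor_equiv_def
  by (drule (1) complex_vector.span_diff) (simp add: algebra_simps)
lift_definition uminus_tensor :: "('a, 'b) tensor \<Rightarrow> ('a, 'b) tensor" is "uminus"
  unfolding tensor_equiv_def
  by (metis complex_vector.span_neg minus_diff_minus)
lift_definition scaleC_tensor :: "complex \<Rightarrow> ('a, 'b) tensor \<Rightarrow> ('a, 'b) tensor" is "scaleC"
  unfolding tensor_equiv_def
  by (metis complex_vector.span_scale complex_vector.scale_right_diff_distrib)
instance
  by standard
    (transfer, simp add: tensor_equiv_def complex_vector.span_zero scaleC_add_right
       scaleC_add_left scaleC_scaleC scaleC_one algebra_simps)+
end

definition tensor_pair :: "'a::complex_vector \<Rightarrow> 'b::complex_vector \<Rightarrow> ('a, 'b) tensor"
    (infixr "\<otimes>" 70)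
  where "x \<otimes> y = abs_tensor (Poly_Mapping.single (x, y) 1)"

definition bilinear_map ::
    "('a::complex_vector \<Rightarrow> 'b::complex_vector \<Rightarrow> 'v::complex_vector) \<Rightarrow> bool"
  where "bilinear_map f \<longleftrightarrow> (\<forall>y. clinear (\<lambda>x. f x y)) \<and> (\<forall>x. clinear (\<lambda>y. f x y))"

text \<open>The linear map taking \<open>x \<otimes> y\<close> to \<open>f x y\<close>, for bilinear \<open>f\<close>.\<close>

definition lift_tensor ::
    "('a::complex_vector \<Rightarrow> 'b::complex_vector \<Rightarrow> 'v::complex_vector) \<Rightarrow> ('a, 'b) tensor \<Rightarrow> 'v"
  where "lift_tensor f t = lin_ext (\<lambda>(x, y). f x y) (rep_tensor t)"

lemma bilinear_map_tensor_pair: "bilinear_map (\<otimes>)"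
  unfolding bilinear_map_def clinear_iff
proof (intro conjI allI)
  fix x x' :: 'a and y y' :: 'b and s
  show "(x + x') \<otimes> y = x \<otimes> y + x' \<otimes> y"
    unfolding tensor_pair_def plus_tensor.abs_eq tensor.abs_eq_iff tensor_equiv_def
    using complex_vector.span_base[OF tensor_add_left[of x x' y]] by (simp add: diff_diff_eq)
  show "x \<otimes> (y + y') = x \<otimes> y + x \<otimes> y'"
    unfolding tensor_pair_def plus_tensor.abs_eq tensor.abs_eq_iff tensor_equiv_def
    using complex_vector.span_base[OF tensor_add_right[of x y y']] by (simp add: diff_diff_eq)
  show "(s *\<^sub>C x) \<otimes> y = s *\<^sub>C (x \<otimes> y)"
    unfolding tensor_pair_def scaleC_tensor.abs_eq tensor.abs_eq_iff tensor_equiv_def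
    by (rule complex_vector.span_base[OF tensor_scale_left])
  show "x \<otimes> (s *\<^sub>C y) = s *\<^sub>C (x \<otimes> y)"
    unfolding tensor_pair_def scaleC_tensor.abs_eq tensor.abs_eq_iff tensor_equiv_def
    by (rule complex_vector.span_base[OF tensor_scale_right])
qed

lemma clinear_tensor_left: "clinear (\<lambda>x. x \<otimes> y)"
  by (rule bilinear_map_tensor_pair[unfolded bilinear_map_def, THEN conjunct1, rule_format])

lemma clinear_tensor_right: "clinear (\<lambda>y. x \<otimes> y)"
  by (rule bilinear_map_tensor_pair[unfolded bilinear_map_def, THEN conjunct2, rule_format])

lemma lift_tensor_abs:
  assumes "bilinear_map f"
  shows "lift_tensor f (abs_tensor h) = lin_ext (\<lambda>(x, y). f x y) h"
proof -
  let ?f = "\<lambda>(x, y). f x y"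
  have "tensor_equiv (rep_tensor (abs_tensor h)) h"
    by (rule Quotient3_rep_abs[OF Quotient3_tensor]) (simp add: tensor.abs_eq_iff[symmetric])
  then have "rep_tensor (abs_tensor h) - h \<in> complex_vector.span tensor_relations"
    by (simp add: tensor_equiv_def)
  moreover have "lin_ext ?f r = 0" if "r \<in> tensor_relations" for r
    using that
    by cases (use assms clinear_lin_ext[of ?f] in
      \<open>auto simp: bilinear_map_def clinear_iff lin_ext_single scaleC_one
        clinear_diff[OF clinear_lin_ext]\<close>)
  ultimately have "lin_ext ?f (rep_tensor (abs_tensor h) - h) = 0"
    by (rule lin_ext_span[rotated])
  then show ?thesis by (simp add: lift_tensor_def clinear_diff[OF clinear_lin_ext])
qed

lemma lift_tensor_pair [simp]: "bilinear_map f \<Longrightarrow> lift_tensor f (x \<otimes> y) = f x y"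
  by (simp add: tensor_pair_def lift_tensor_abs lin_ext_single scaleC_one)

lemma clinear_lift_tensor:
  assumes "bilinear_map f"
  shows "clinear (lift_tensor f)"
  unfolding clinear_iff
proof (intro conjI allI)
  fix t u :: "('a, 'b) tensor" and c
  obtain h k :: "('a \<times> 'b) \<Rightarrow>\<^sub>0 complex" where [simp]: "t = abs_tensor h" "u = abs_tensor k"
    by (metis Quotient3_abs_rep[OF Quotient3_tensor])
  note [simp] = lift_tensor_abs[OF assms]
  show "lift_tensor f (t + u) = lift_tensor f t + lift_tensor f u"
    using clinear_lin_ext[of "\<lambda>(x, y). f x y"] by (simp add: plus_tensor.abs_eq clinear_iff)
  show "lift_tensor f (c *\<^sub>C t) = c *\<^sub>C lift_tensor f t"
    using clinear_lin_ext[of "\<lambda>(x, y). f x y"] by (simp add: scaleC_tensor.abs_eq clinear_iff)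
qed

lemma tensor_expansion: "\<exists>A a. finite A \<and> t = (\<Sum>(x, y)\<in>A. a (x, y) *\<^sub>C (x \<otimes> y))"
proof -
  obtain f where [simp]: "t = abs_tensor f"
    by (metis Quotient3_abs_rep[OF Quotient3_tensor])
  have lin: "clinear (abs_tensor :: ('a \<times> 'b \<Rightarrow>\<^sub>0 complex) \<Rightarrow> _)"
    by (auto simp: clinear_iff plus_tensor.abs_eq scaleC_tensor.abs_eq)
  have "abs_tensor f = abs_tensor (\<Sum>k\<in>Poly_Mapping.keys f. Poly_Mapping.lookup f k *\<^sub>C Poly_Mapping.single k 1)"
    using free_induct[of f] by simp
  also have "\<dots> = (\<Sum>(x, y)\<in>Poly_Mapping.keys f. Poly_Mapping.lookup f (x, y) *\<^sub>C (x \<otimes> y))"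
    by (simp add: clinear_sum[OF lin] tensor_pair_def case_prod_unfold lin[unfolded clinear_iff])
  finally have "t = (\<Sum>(x, y)\<in>Poly_Mapping.keys f. Poly_Mapping.lookup f (x, y) *\<^sub>C (x \<otimes> y))" by simp
  then show ?thesis using finite_keys by blast
qed

lemma clinear_eq_on_tensor:
  assumes "clinear f" "clinear g" "\<And>x y. f (x \<otimes> y) = g (x \<otimes> y)"
  shows "f t = g t"
proof -
  obtain A a where "finite A" "t = (\<Sum>(x, y)\<in>A. a (x, y) *\<^sub>C (x \<otimes> y))"
    using tensor_expansion by blast
  then show ?thesis
    using assms by (simp add: clinear_sum case_prod_unfold) (simp add: clinear_iff)
qed

section \<open>Free difference quotient, cyclic derivative and cyclic rotation\<close>

text \<open>\<open>b\<^sub>0 X b\<^sub>1 \<dots> X b\<^sub>n \<mapsto> \<Sum>i=1..n. b\<^sub>0 X \<dots> X b\<^bsub>i-1\<^esub> \<otimes> b\<^sub>i X \<dots> X b\<^sub>n\<close>, the list having length \<open>n + 1\<close>. The lemmas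
  \<open>partial_coef\<close>, \<open>partial_var\<close> and \<open>partial_leibniz\<close> below show that this is the derivation that
  vanishes on \<open>B\<close> and sends \<open>X\<close> to \<open>1 \<otimes> 1\<close>.\<close>

definition partial_X :: "'b::unital_complex_algebra free_X \<Rightarrow> ('b free_X, 'b free_X) tensor" where
  "partial_X = lift_monom (\<lambda>bs. \<Sum>i\<in>{1..<length bs}. monom (take i bs) \<otimes> monom (drop i bs))"

definition tensor_swap :: "('a::complex_vector, 'b::complex_vector) tensor \<Rightarrow> ('b, 'a) tensor"
  where "tensor_swap = lift_tensor (\<lambda>p q. q \<otimes> p)"

definition tensor_mult :: "('a::unital_complex_algebra, 'a) tensor \<Rightarrow> 'a"
  where "tensor_mult = lift_tensor (\<lambda>p q. p * q)"

definition delta_X :: "'b::unital_complex_algebra free_X \<Rightarrow> 'b free_X"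
  where "delta_X = tensor_mult \<circ> tensor_swap \<circ> partial_X"

text \<open>\<open>b\<^sub>0 X b\<^sub>1 \<dots> X b\<^sub>n \<mapsto> b\<^sub>1 X b\<^sub>2 \<dots> X b\<^sub>n X b\<^sub>0\<close>\<close>

definition rho :: "'b::unital_complex_algebra free_X \<Rightarrow> 'b free_X"
  where "rho = lift_monom (\<lambda>bs. monom (rotate1 bs))"

definition Theta :: "'b::unital_complex_algebra free_X \<Rightarrow> 'b free_X"
  where "Theta = (\<lambda>p. id p - rho p)"

definition linear_ker :: "('a::complex_vector \<Rightarrow> 'v::complex_vector) \<Rightarrow> 'a set"
  where "linear_ker f = {x. f x = 0}"

lemma multilinear_rho: "multilinear (\<lambda>bs. monom (rotate1 bs))"
  unfolding multilinear_def
proof (intro conjI allI)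
  fix xs ys :: "'a list"
  show "clinear (\<lambda>b. monom (rotate1 (xs @ b # ys)))"
    using clinear_monom[of ys "[]"] clinear_monom[of "tl xs" "ys @ [hd xs]"] by (cases xs) auto
qed simp

lemma clinear_rho: "clinear rho"
  unfolding rho_def by (rule clinear_lift_monom[OF multilinear_rho])

lemma rho_monom: "rho (monom (b # bs)) = monom (bs @ [b])"
  unfolding rho_def by (simp add: multilinear_rho)

lemma multilinear_partial:
  "multilinear (\<lambda>bs. \<Sum>i\<in>{1..<length bs}. monom (take i bs) \<otimes> monom (drop i bs))"
  unfolding multilinear_def
proof (intro conjI allI)
  fix xs ys :: "'a list"
  have "clinear (\<lambda>b. monom (take i (xs @ b # ys)) \<otimes> monom (drop i (xs @ b # ys)))" for i
  proof (cases "i \<le> length xs")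
    case True
    then show ?thesis
      using clinear_compose[OF clinear_tensor_right[of "monom (take i xs)"] clinear_monom[of "drop i xs" ys]] by simp
  next
    case False
    then obtain k where "i = length xs + Suc k"
      by (metis add_Suc_right less_imp_Suc_add not_le_imp_less)
    then show ?thesis
      using clinear_compose[OF clinear_tensor_left[of "monom (drop k ys)"] clinear_monom[of xs "take k ys"]] by simp
  qed
  then show "clinear (\<lambda>b. \<Sum>i\<in>{1..<length (xs @ b # ys)}.
      monom (take i (xs @ b # ys)) \<otimes> monom (drop i (xs @ b # ys)))"
    by (simp only: length_append list.size) (rule clinear_sum_fun)
qed simp

lemma clinear_partial: "clinear partial_X"
  unfolding partial_X_def by (rule clinear_lift_monom[OF multilinear_partial])

lemma partial_monom:
  "partial_X (monom bs) = (\<Sum>i\<in>{1..<length bs}. monom (take i bs) \<otimes> monom (drop i bs))"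
  unfolding partial_X_def by (rule lift_monom_monom[OF multilinear_partial])

lemma partial_coef: "partial_X (coef b) = 0"
  by (simp add: coef_def partial_monom)

lemma partial_var: "partial_X var_X = 1 \<otimes> 1"
  by (simp add: var_X_def partial_monom one_free_X_def numeral_2_eq_2)

lemma bilinear_map_swap: "bilinear_map (\<lambda>p q. q \<otimes> p)"
  by (simp add: bilinear_map_def clinear_tensor_left clinear_tensor_right)

lemma tensor_swap_pair: "tensor_swap (p \<otimes> q) = q \<otimes> p"
  unfolding tensor_swap_def by (simp add: bilinear_map_swap)

lemma clinear_swap: "clinear tensor_swap"
  unfolding tensor_swap_def by (rule clinear_lift_tensor[OF bilinear_map_swap])

lemma bilinear_map_mult: "bilinear_map (\<lambda>p q :: 'a::unital_complex_algebra. p * q)"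
  by (simp add: bilinear_map_def clinear_mult_left clinear_mult_right)

lemma tensor_mult_pair: "tensor_mult (p \<otimes> q) = p * q"
  unfolding tensor_mult_def by (simp add: bilinear_map_mult)

lemma clinear_tensor_mult: "clinear tensor_mult"
  unfolding tensor_mult_def by (rule clinear_lift_tensor[OF bilinear_map_mult])

lemma clinear_delta: "clinear delta_X"
  unfolding delta_X_def comp_def
  by (intro clinear_compose[OF clinear_tensor_mult] clinear_compose[OF clinear_swap] clinear_partial)

lemma delta_monom:
  "delta_X (monom bs) = (\<Sum>i\<in>{1..<length bs}. monom (drop i bs) * monom (take i bs))"
  by (simp add: delta_X_def partial_monom clinear_sum[OF clinear_swap]
      clinear_sum[OF clinear_tensor_mult] tensor_swap_pair tensor_mult_pair)

text \<open>The bimodule structure of the tensor square and the Leibniz rule.\<close>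

definition left_act :: "'a::unital_complex_algebra \<Rightarrow> ('a, 'a) tensor \<Rightarrow> ('a, 'a) tensor"
  where "left_act a = lift_tensor (\<lambda>p q. (a * p) \<otimes> q)"

definition right_act :: "('a::unital_complex_algebra, 'a) tensor \<Rightarrow> 'a \<Rightarrow> ('a, 'a) tensor"
  where "right_act t a = lift_tensor (\<lambda>p q. p \<otimes> (q * a)) t"

lemma bilinear_map_left_act: "bilinear_map (\<lambda>p q. (a * p) \<otimes> q)"
  for a :: "'a::unital_complex_algebra"
  unfolding bilinear_map_def
  by (intro conjI allI clinear_tensor_right
      clinear_compose[OF clinear_tensor_left clinear_mult_right[of a]])

lemma bilinear_map_right_act: "bilinear_map (\<lambda>p q. p \<otimes> (q * a))"
  for a :: "'a::unital_complex_algebra"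
  unfolding bilinear_map_def
  by (intro conjI allI clinear_tensor_left
      clinear_compose[OF clinear_tensor_right clinear_mult_left[of a]])

lemma left_act_pair: "left_act a (p \<otimes> q) = (a * p) \<otimes> q"
  unfolding left_act_def by (simp add: bilinear_map_left_act)

lemma right_act_pair: "right_act (p \<otimes> q) a = p \<otimes> (q * a)"
  unfolding right_act_def by (simp add: bilinear_map_right_act)

lemma clinear_left_act: "clinear (left_act a)" "clinear (\<lambda>a. left_act a t)"
proof -
  show "clinear (left_act a)"
    unfolding left_act_def by (rule clinear_lift_tensor[OF bilinear_map_left_act])
  show "clinear (\<lambda>a. left_act a t)"
    unfolding left_act_def lift_tensor_def lin_ext_def case_prod_unfold
    by (intro clinear_sum_fun clinear_scale
        clinear_compose[OF clinear_tensor_left clinear_mult_left])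
qed

lemma clinear_right_act: "clinear (\<lambda>t. right_act t a)" "clinear (right_act t)"
proof -
  show "clinear (\<lambda>t. right_act t a)"
    unfolding right_act_def by (rule clinear_lift_tensor[OF bilinear_map_right_act])
  show "clinear (right_act t)"
    unfolding right_act_def[abs_def] lift_tensor_def lin_ext_def case_prod_unfold
    by (intro clinear_sum_fun clinear_scale
        clinear_compose[OF clinear_tensor_right clinear_mult_right])
qed

lemma partial_mult_monom:
  "partial_X (monom (us @ [b]) * monom (c # vs)) =
     left_act (monom (us @ [b])) (partial_X (monom (c # vs)))
   + right_act (partial_X (monom (us @ [b]))) (monom (c # vs))"
proof -
  let ?w = "us @ (b * c) # vs"
  let ?f = "\<lambda>i. monom (take i ?w) \<otimes> monom (drop i ?w)"
  let ?m = "Suc (length us)"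
  have "{1..<length ?w} = {1..<?m} \<union> {?m..<?m + length vs}" by auto
  then have "partial_X (monom (us @ [b]) * monom (c # vs)) = sum ?f {1..<?m} + sum ?f {?m..<?m + length vs}"
    by (simp add: monom_mult word_mult_def partial_monom sum.union_disjoint del: sum.op_ivl_Suc)
  also have "sum ?f {1..<?m} = right_act (partial_X (monom (us @ [b]))) (monom (c # vs))"
    unfolding partial_monom clinear_sum[OF clinear_right_act(1)]
    by (rule sum.cong) (auto simp: right_act_pair monom_mult word_mult_def butlast_append)
  also have "sum ?f {?m..<?m + length vs} = (\<Sum>k\<in>{1..<1 + length vs}. ?f (k + length us))"
    using sum.shift_bounds_nat_ivl[of ?f 1 "length us" "1 + length vs"] by (simp add: add.commute)
  also have "\<dots> = left_act (monom (us @ [b])) (partial_X (monom (c # vs)))"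
    unfolding partial_monom clinear_sum[OF clinear_left_act(1)]
  proof (rule sum.cong)
    show "{1..<1 + length vs} = {1..<length (c # vs)}" by simp
  next
    fix k assume "k \<in> {1..<length (c # vs)}"
    then obtain j where "k = Suc j" by (cases k) auto
    then show "?f (k + length us) =
        left_act (monom (us @ [b])) (monom (take k (c # vs)) \<otimes> monom (drop k (c # vs)))"
      by (simp add: left_act_pair monom_mult word_mult_def)
  qed
  finally show ?thesis by (simp add: add.commute)
qed

lemma partial_leibniz: "partial_X (p * q) = left_act p (partial_X q) + right_act (partial_X p) q"
proof (rule clinear_eq_on_monom[of "\<lambda>p. partial_X (p * q)"
      "\<lambda>p. left_act p (partial_X q) + right_act (partial_X p) q"])
  show "clinear (\<lambda>p. partial_X (p * q))"
    by (rule clinear_compose[OF clinear_partial clinear_mult_left])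
  show "clinear (\<lambda>p. left_act p (partial_X q) + right_act (partial_X p) q)"
    by (intro clinear_add clinear_left_act clinear_compose[OF clinear_right_act(1)] clinear_partial)
  fix xs :: "'a list" assume xs: "xs \<noteq> []"
  show "partial_X (monom xs * q) = left_act (monom xs) (partial_X q) + right_act (partial_X (monom xs)) q"
  proof (rule clinear_eq_on_monom[of "\<lambda>q. partial_X (monom xs * q)"
        "\<lambda>q. left_act (monom xs) (partial_X q) + right_act (partial_X (monom xs)) q"])
    show "clinear (\<lambda>q. partial_X (monom xs * q))"
      by (rule clinear_compose[OF clinear_partial clinear_mult_right])
    show "clinear (\<lambda>q. left_act (monom xs) (partial_X q) + right_act (partial_X (monom xs)) q)"
      by (intro clinear_add clinear_right_act clinear_compose[OF clinear_left_act(1)] clinear_partial)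
    fix ys :: "'a list" assume "ys \<noteq> []"
    then show "partial_X (monom xs * monom ys) =
        left_act (monom xs) (partial_X (monom ys)) + right_act (partial_X (monom xs)) (monom ys)"
      using partial_mult_monom xs by (metis append_butlast_last_id list.exhaust)
  qed
qed

end

theory Submission
  imports Defs
begin

text \<open>On monomials the cyclic derivative is a sum over all cyclic rotations: for \<open>n \<ge> 1\<close>,
  \<open>\<delta>[b\<^sub>0 X b\<^sub>1 \<dots> X b\<^sub>n]\<close> is the sum of the monomials whose coefficient words are the \<open>n\<close> rotations of
  \<open>b\<^sub>1, \<dots>, b\<^bsub>n-1\<^esub>, b\<^sub>n b\<^sub>0\<close> (\<open>delta_monom_cyclic_sum\<close>), while \<open>\<delta>[b\<^sub>0] = 0\<close>. Such a cyclic sum does not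
  change under one further rotation, so the range of \<open>\<delta>\<close> consists of fixed points of \<open>\<rho>\<close>.

  Conversely, let \<open>N\<close> (\<open>cyclic_average\<close>) be the averaging operator which takes a monomial with \<open>n\<close>
  coefficients to \<open>1/n\<close> times its cyclic sum. Dividing each monomial of \<open>q\<close> by its number of
  coefficients and multiplying by \<open>X\<close> from the right gives an element with cyclic derivative \<open>N q\<close>
  (\<open>delta_length_normalize_mult_var\<close>), so it remains to see that \<open>N q = q\<close> if \<open>\<rho> q = q\<close>.
  On words with \<open>n\<close> coefficients, telescoping yields

  \<open>id - 1/n (\<Sum>k<n. \<rho>\<^sup>k) = (1/n (\<Sum>k<n. \<Sum>j<k. \<rho>\<^sup>j)) \<circ> (id - \<rho>)\<close>.

  The factor in front of \<open>id - \<rho>\<close> extends to a linear map \<open>H\<close> (\<open>rotation_homotopy\<close>) on \<open>B\<langle>X\<rangle>\<close>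
  with \<open>H \<circ> \<Theta> = id - N\<close> (\<open>rotation_homotopy_Theta\<close>); hence \<open>\<Theta> q = 0\<close> implies \<open>q = N q\<close>.
  No decomposition of \<open>q\<close> into homogeneous components is needed.\<close>

section \<open>Multilinear functions of words\<close>

text \<open>Linearity in each coefficient only compares words of the same length, so the function may be
  chosen depending on the length.\<close>

lemma multilinear_length_dependent:
  assumes "\<And>n. multilinear (f n)"
  shows "multilinear (\<lambda>bs. f (length bs) bs)"
  using assms by (simp add: multilinear_def)

lemma multilinear_sum:
  assumes "\<And>i. i \<in> I \<Longrightarrow> multilinear (f i)"
  shows "multilinear (\<lambda>bs. \<Sum>i\<in>I. f i bs)"
  using assms by (simp add: multilinear_def clinear_sum_fun)

lemma multilinear_scale:
  assumes "multilinear f"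
  shows "multilinear (\<lambda>bs. c *\<^sub>C f bs)"
  using assms by (simp add: multilinear_def clinear_scale)

lemma multilinear_rotate1:
  assumes "multilinear f"
  shows "multilinear (\<lambda>bs. f (rotate1 bs))"
  unfolding multilinear_def
proof (intro conjI allI)
  show "f (rotate1 []) = 0"
    using assms by (simp add: multilinear_def)
next
  fix xs ys
  have *: "clinear (\<lambda>b. f (us @ b # vs))" for us vs
    using assms by (simp add: multilinear_def)
  show "clinear (\<lambda>b. f (rotate1 (xs @ b # ys)))"
    using *[of ys "[]"] *[of "tl xs" "ys @ [hd xs]"] by (cases xs) auto
qed

lemma multilinear_rotate:
  assumes "multilinear f"
  shows "multilinear (\<lambda>bs. f (rotate k bs))"
proof (induction k)
  case 0
  then show ?case using assms by simp
next
  case (Suc k)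
  then show ?case
    using multilinear_rotate1[OF Suc] by (simp add: rotate_def funpow_Suc_right del: funpow.simps)
qed

section \<open>Cyclic sums\<close>

text \<open>The sum of all rotations of a word, with multiplicity if the word is periodic.\<close>

definition cyclic_sum :: "'b::complex_vector list \<Rightarrow> 'b free_X" where
  "cyclic_sum bs = (\<Sum>k<length bs. monom (rotate k bs))"

lemma cyclic_sum_rotate1: "cyclic_sum (rotate1 bs) = cyclic_sum bs"
proof -
  let ?f = "\<lambda>k. monom (rotate k bs)"
  have "cyclic_sum (rotate1 bs) = (\<Sum>k<length bs. ?f (Suc k))"
    by (simp add: cyclic_sum_def rotate1_rotate_swap)
  also have "\<dots> = (\<Sum>k<length bs. ?f k) + ?f (length bs) - ?f 0"
    using sum.lessThan_Suc_shift[of ?f "length bs"] by (simp add: algebra_simps)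
  also have "\<dots> = cyclic_sum bs"
    by (simp add: cyclic_sum_def)
  finally show ?thesis .
qed

lemma rho_monom_rotate1: "rho (monom bs) = monom (rotate1 bs)"
  unfolding rho_def by (rule lift_monom_monom[OF multilinear_rho])

lemma rho_cyclic_sum: "rho (cyclic_sum bs) = cyclic_sum bs"
proof -
  have "rho (cyclic_sum bs) = cyclic_sum (rotate1 bs)"
    by (simp add: cyclic_sum_def clinear_sum[OF clinear_rho] rho_monom_rotate1 rotate1_rotate_swap)
  then show ?thesis by (simp only: cyclic_sum_rotate1)
qed

lemma delta_monom_cyclic_sum: "delta_X (monom (a # bs @ [c])) = cyclic_sum (bs @ [c * a])"
proof -
  let ?w = "a # bs @ [c]"
  have *: "monom (drop (Suc k) ?w) * monom (take (Suc k) ?w) = monom (rotate k (bs @ [c * a]))"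
    if "k < Suc (length bs)" for k
    using that by (simp add: monom_mult word_mult_def rotate_drop_take)
  have "delta_X (monom ?w) =
      (\<Sum>i\<in>{Suc 0..<Suc (Suc (length bs))}. monom (drop i ?w) * monom (take i ?w))"
    by (simp add: delta_monom del: sum.op_ivl_Suc)
  also have "\<dots> = (\<Sum>k<Suc (length bs). monom (drop (Suc k) ?w) * monom (take (Suc k) ?w))"
    by (simp only: sum.shift_bounds_Suc_ivl lessThan_atLeast0)
  also have "\<dots> = cyclic_sum (bs @ [c * a])"
    unfolding cyclic_sum_def by (rule sum.cong) (auto intro!: * simp del: drop_Suc_Cons take_Suc_Cons)
  finally show ?thesis .
qed

lemma rho_delta: "rho (delta_X p) = delta_X p"
proof (rule clinear_eq_on_monom[of "\<lambda>p. rho (delta_X p)"])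
  show "clinear (\<lambda>p. rho (delta_X p))"
    by (rule clinear_compose[OF clinear_rho clinear_delta])
  show "clinear delta_X"
    by (rule clinear_delta)
  fix bs :: "'a list" assume "bs \<noteq> []"
  then obtain a bs' where bs: "bs = a # bs'" by (cases bs) auto
  show "rho (delta_X (monom bs)) = delta_X (monom bs)"
  proof (cases bs' rule: rev_cases)
    case Nil
    then show ?thesis by (simp add: bs delta_monom clinear_zero[OF clinear_rho])
  next
    case (snoc ys c)
    then show ?thesis by (simp add: bs delta_monom_cyclic_sum rho_cyclic_sum)
  qed
qed

lemma monom_mult_var: "bs \<noteq> [] \<Longrightarrow> monom bs * var_X = monom (bs @ [1])"
  by (cases bs rule: rev_cases) (simp_all add: var_X_def monom_mult word_mult_def)

lemma delta_monom_mult_var: "delta_X (monom bs * var_X) = cyclic_sum bs"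
proof (cases bs)
  case Nil
  then show ?thesis by (simp add: cyclic_sum_def clinear_zero[OF clinear_delta])
next
  case (Cons a bs')
  then have "delta_X (monom bs * var_X) = cyclic_sum (bs' @ [a])"
    by (simp add: monom_mult_var delta_monom_cyclic_sum)
  also have "\<dots> = cyclic_sum bs"
    using cyclic_sum_rotate1[of bs] Cons by simp
  finally show ?thesis .
qed

section \<open>Averaging over rotations\<close>

text \<open>The three maps below involve the factor \<open>1/n\<close> for words of length \<open>n\<close>. The empty word, for
  which this is \<open>1/0 = 0\<close>, stands for the zero element.\<close>

text \<open>Division of each monomial by its number of coefficients.\<close>

definition length_normalize :: "'b::complex_vector free_X \<Rightarrow> 'b free_X" where
  "length_normalize = lift_monom (\<lambda>bs. (1 / of_nat (length bs)) *\<^sub>C monom bs)"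

text \<open>The projection onto the rotation-invariant elements.\<close>

definition cyclic_average :: "'b::complex_vector free_X \<Rightarrow> 'b free_X" where
  "cyclic_average = lift_monom (\<lambda>bs. (1 / of_nat (length bs)) *\<^sub>C cyclic_sum bs)"

text \<open>On words of length \<open>n\<close>, the quotient of \<open>id - 1/n (id + \<rho> + \<dots> + \<rho>\<^bsup>n-1\<^esup>)\<close> by \<open>id - \<rho>\<close>.\<close>

definition rotation_homotopy :: "'b::complex_vector free_X \<Rightarrow> 'b free_X" where
  "rotation_homotopy = lift_monom (\<lambda>bs. (1 / of_nat (length bs)) *\<^sub>C
     (\<Sum>k<length bs. \<Sum>j<k. monom (rotate j bs)))"

lemma multilinear_length_normalize:
  "multilinear (\<lambda>bs. (1 / of_nat (length bs)) *\<^sub>C monom bs)"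
  by (intro multilinear_length_dependent[where f = "\<lambda>n bs. (1 / of_nat n) *\<^sub>C monom bs"]
      multilinear_scale multilinear_monom)

lemma multilinear_cyclic_average:
  "multilinear (\<lambda>bs. (1 / of_nat (length bs)) *\<^sub>C cyclic_sum bs)"
  unfolding cyclic_sum_def
  by (intro multilinear_length_dependent
      [where f = "\<lambda>n bs. (1 / of_nat n) *\<^sub>C (\<Sum>k<n. monom (rotate k bs))"]
      multilinear_scale multilinear_sum multilinear_rotate multilinear_monom)

lemma multilinear_rotation_homotopy:
  "multilinear (\<lambda>bs. (1 / of_nat (length bs)) *\<^sub>C (\<Sum>k<length bs. \<Sum>j<k. monom (rotate j bs)))"
  by (intro multilinear_length_dependent
      [where f = "\<lambda>n bs. (1 / of_nat n) *\<^sub>C (\<Sum>k<n. \<Sum>j<k. monom (rotate j bs))"]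
      multilinear_scale multilinear_sum multilinear_rotate multilinear_monom)

lemma clinear_length_normalize: "clinear length_normalize"
  unfolding length_normalize_def by (rule clinear_lift_monom[OF multilinear_length_normalize])

lemma clinear_cyclic_average: "clinear cyclic_average"
  unfolding cyclic_average_def by (rule clinear_lift_monom[OF multilinear_cyclic_average])

lemma clinear_rotation_homotopy: "clinear rotation_homotopy"
  unfolding rotation_homotopy_def by (rule clinear_lift_monom[OF multilinear_rotation_homotopy])

lemma length_normalize_monom:
  "length_normalize (monom bs) = (1 / of_nat (length bs)) *\<^sub>C monom bs"
  unfolding length_normalize_def by (rule lift_monom_monom[OF multilinear_length_normalize])

lemma cyclic_average_monom:
  "cyclic_average (monom bs) = (1 / of_nat (length bs)) *\<^sub>C cyclic_sum bs"
  unfolding cyclic_average_def by (rule lift_monom_monom[OF multilinear_cyclic_average])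

lemma rotation_homotopy_monom:
  "rotation_homotopy (monom bs) =
     (1 / of_nat (length bs)) *\<^sub>C (\<Sum>k<length bs. \<Sum>j<k. monom (rotate j bs))"
  unfolding rotation_homotopy_def by (rule lift_monom_monom[OF multilinear_rotation_homotopy])

lemma delta_length_normalize_mult_var: "delta_X (length_normalize q * var_X) = cyclic_average q"
proof (rule clinear_eq_on_monom[of "\<lambda>q. delta_X (length_normalize q * var_X)"])
  show "clinear (\<lambda>q. delta_X (length_normalize q * var_X))"
    by (intro clinear_compose[OF clinear_delta] clinear_compose[OF clinear_mult_left]
        clinear_length_normalize)
  show "clinear cyclic_average"
    by (rule clinear_cyclic_average)
  fix bs :: "'a list"
  show "delta_X (length_normalize (monom bs) * var_X) = cyclic_average (monom bs)"
    by (simp add: length_normalize_monom cyclic_average_monom mult_scaleC_left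
        delta_monom_mult_var clinear_delta[unfolded clinear_iff])
qed

lemma scaleC_of_nat: "of_nat n *\<^sub>C x = (\<Sum>k<n. x)"
  by (induction n) (simp_all add: scaleC_add_left scaleC_one add.commute)

lemma clinear_Theta: "clinear Theta"
  using clinear_rho by (auto simp: Theta_def clinear_iff complex_vector.scale_right_diff_distrib)

lemma rotation_homotopy_Theta: "rotation_homotopy (Theta q) = q - cyclic_average q"
proof (rule clinear_eq_on_monom[of "\<lambda>q. rotation_homotopy (Theta q)" "\<lambda>q. q - cyclic_average q"])
  show "clinear (\<lambda>q. rotation_homotopy (Theta q))"
    by (rule clinear_compose[OF clinear_rotation_homotopy clinear_Theta])
  show "clinear (\<lambda>q. q - cyclic_average q)"
    using clinear_cyclic_average
    by (auto simp: clinear_iff complex_vector.scale_right_diff_distrib)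
  fix bs :: "'a list" assume "bs \<noteq> []"
  let ?n = "length bs" and ?m = "\<lambda>j. monom (rotate j bs)"
  have telescope: "(\<Sum>j<k. ?m j) - (\<Sum>j<k. ?m (Suc j)) = monom bs - ?m k" for k
    using sum_lessThan_telescope'[of ?m k] by (simp flip: sum_subtractf)
  have "rotation_homotopy (Theta (monom bs)) =
      rotation_homotopy (monom bs) - rotation_homotopy (monom (rotate1 bs))"
    by (simp add: Theta_def rho_monom_rotate1 clinear_diff[OF clinear_rotation_homotopy])
  also have "\<dots> = (1 / of_nat ?n) *\<^sub>C (\<Sum>k<?n. (\<Sum>j<k. ?m j) - (\<Sum>j<k. ?m (Suc j)))"
    by (simp add: rotation_homotopy_monom sum_subtractf complex_vector.scale_right_diff_distrib
        rotate1_rotate_swap)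
  also have "\<dots> = (1 / of_nat ?n) *\<^sub>C (of_nat ?n *\<^sub>C monom bs - cyclic_sum bs)"
    by (simp only: telescope scaleC_of_nat sum_subtractf cyclic_sum_def)
  also have "\<dots> = monom bs - cyclic_average (monom bs)"
    using \<open>bs \<noteq> []\<close>
    by (simp add: cyclic_average_monom complex_vector.scale_right_diff_distrib scaleC_scaleC
        scaleC_one)
  finally show "rotation_homotopy (Theta (monom bs)) = monom bs - cyclic_average (monom bs)" .
qed

section \<open>The range of the cyclic derivative\<close>

theorem theorem9p3:
  fixes q :: "'b::unital_complex_algebra free_X"
  shows "(\<exists>p :: 'b free_X. delta_X p = q) \<longleftrightarrow> q \<in> linear_ker Theta"
proof
  assume "\<exists>p :: 'b free_X. delta_X p = q"
  then show "q \<in> linear_ker Theta"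
    by (auto simp: linear_ker_def Theta_def rho_delta)
next
  assume "q \<in> linear_ker Theta"
  then have "q = cyclic_average q"
    using rotation_homotopy_Theta[of q]
    by (simp add: linear_ker_def clinear_zero[OF clinear_rotation_homotopy])
  then have "delta_X (length_normalize q * var_X) = q"
    by (simp add: delta_length_normalize_mult_var)
  then show "\<exists>p :: 'b free_X. delta_X p = q" ..
qed

end
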